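(* Let $\mathcal{R} = (X, \mathbf{R})$ be a relational structure on a countably infinite set $X$. If $|\mathbf{R}|$ is finite, then $\operatorname{pAut}(\mathcal{R}) \approx_I I_X$.
   Context: For a set $X$, $I_X$ is the symmetric inverse monoid: the set of all bijections between subsets of $X$ (partial bijections, called charts) under composition of partial functions, written left to right (the image of $x$ under $f$ is $xf$). For subsemigroups $S_1, S_2$ of $I_X$, write $S_1 \preccurlyeq_I S_2$ if there is a finite set $U \subseteq I_X$ such that $S_1 \subseteq \langle S_2 \cup U \rangle$, where $\langle\cdot\rangle$ denotes the semigroup generated; $S_1 \approx_I S_2$ means $S_1 \preccurlyeq_I S_2$ and $S_2 \preccurlyeq_I S_1$. A relational structure $\mathcal{R} = (X,\mathbf{R})$ on $X$ consists of $X$ together with a set $\mathbf{R}$ of relations on $X$, each $R \in \mathbf{R}$ being a subset of $X^{n}$ for some natural number $n = \operatorname{dim}(R)$, its arity. For $\alpha = (a_0,\dots,a_{n-1}) \in \operatorname{dom}(f)^n$, $\alpha f = (a_0 f, \dots, a_{n-1} f)$. $\operatorname{pAut}(\mathcal{R}) = \{ f \in I_X \mid (\forall R \in \mathbf{R})(\forall \alpha \in \operatorname{dom}(f)^{\operatorname{dim}(R)})\ \alpha f \in R \Leftrightarrow \alpha \in R \}$ is the inverse monoid of partial automorphisms of $\mathcal{R}$. *)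

theory Defs
  imports "HOL-Library.Countable_Set"
begin

text \<open>A chart on \<open>X\<close> (a bijection between two subsets of \<open>X\<close>) is a map whose domain and range
  lie in \<open>X\<close> and which is injective on its domain.\<close>

definition sym_inv_monoid :: "'a set \<Rightarrow> ('a \<rightharpoonup> 'a) set" where
  "sym_inv_monoid X = {f. dom f \<subseteq> X \<and> ran f \<subseteq> X \<and> inj_on f (dom f)}"

text \<open>Composition is written left to right: first \<open>f\<close>, then \<open>g\<close>.\<close>

definition chart_comp :: "('a \<rightharpoonup> 'a) \<Rightarrow> ('a \<rightharpoonup> 'a) \<Rightarrow> ('a \<rightharpoonup> 'a)" (infixl "\<odot>" 70) where
  "f \<odot> g = map_comp g f"

text \<open>The semigroup generated by \<open>A\<close>: products of nonempty finite sequences from \<open>A\<close>, so the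
  identity is not included automatically.\<close>

inductive_set semigroup_span :: "('a \<rightharpoonup> 'a) set \<Rightarrow> ('a \<rightharpoonup> 'a) set"
  for A :: "('a \<rightharpoonup> 'a) set" where
  incl: "f \<in> A \<Longrightarrow> f \<in> semigroup_span A"
| mult: "f \<in> semigroup_span A \<Longrightarrow> g \<in> semigroup_span A \<Longrightarrow> f \<odot> g \<in> semigroup_span A"

definition le_I :: "'a set \<Rightarrow> ('a \<rightharpoonup> 'a) set \<Rightarrow> ('a \<rightharpoonup> 'a) set \<Rightarrow> bool" where
  "le_I X S1 S2 \<longleftrightarrow>
     (\<exists>U. finite U \<and> U \<subseteq> sym_inv_monoid X \<and> S1 \<subseteq> semigroup_span (S2 \<union> U))"

definition approx_I :: "'a set \<Rightarrow> ('a \<rightharpoonup> 'a) set \<Rightarrow> ('a \<rightharpoonup> 'a) set \<Rightarrow> bool" where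
  "approx_I X S1 S2 \<longleftrightarrow> le_I X S1 S2 \<and> le_I X S2 S1"

definition tuples :: "'a set \<Rightarrow> nat \<Rightarrow> 'a list set" where
  "tuples X n = {\<alpha>. set \<alpha> \<subseteq> X \<and> length \<alpha> = n}"

definition relational_structure :: "'a set \<Rightarrow> 'a list set set \<Rightarrow> bool" where
  "relational_structure X Rs \<longleftrightarrow> (\<forall>R\<in>Rs. \<exists>n. R \<subseteq> tuples X n)"

text \<open>The arity of a nonempty relation is unique. The empty relation is a relation of every
  arity; it gets an arbitrary one, which is immaterial since every chart preserves it.\<close>

definition arity :: "'a set \<Rightarrow> 'a list set \<Rightarrow> nat" where
  "arity X R = (SOME n. R \<subseteq> tuples X n)"

definition tuple_image :: "('a \<rightharpoonup> 'a) \<Rightarrow> 'a list \<Rightarrow> 'a list" where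
  "tuple_image f \<alpha> = map (\<lambda>a. the (f a)) \<alpha>"

definition pAut :: "'a set \<Rightarrow> 'a list set set \<Rightarrow> ('a \<rightharpoonup> 'a) set" where
  "pAut X Rs = {f \<in> sym_inv_monoid X.
     \<forall>R\<in>Rs. \<forall>\<alpha>\<in>tuples (dom f) (arity X R). tuple_image f \<alpha> \<in> R \<longleftrightarrow> \<alpha> \<in> R}"

end

theory Submission
  imports Defs "HOL-Library.Ramsey"
begin

text \<open>
  Ramsey's theorem yields a sequence \<open>y\<close> in \<open>X\<close> along which every increasing re-indexing
  preserves all relations, so every order-preserving partial injection of \<open>\<nat>\<close>, transported along
  \<open>y\<close>, lies in the partial automorphism monoid. It remains to write an arbitrary partial injection
  \<open>\<phi>\<close> of \<open>\<nat>\<close> as a product of order-preserving ones and a fixed \<open>u\<close>. Take for \<open>u\<close> a partial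
  injection in which every finite pattern occurs in arbitrarily late blocks: then two orders of
  type \<open>\<omega>\<close> that share infinitely many initial segments differ by \<open>g \<odot> u \<odot> g'\<close> with
  \<open>g\<close> and \<open>g'\<close> order-preserving. In general the standard order on \<open>dom \<phi>\<close> and the one pulled
  back along \<open>\<phi>\<close> need not share such segments, but there is an intermediate order sharing infinitely many
  with each of them, so two factors \<open>u\<close> suffice.
\<close>

section \<open>A universal partial injection\<close>

text \<open>The largest offset \<open>2 * m\<close> stops one short of the next square, so blocks
  starting at distinct squares are disjoint.\<close>

lemma square_block_unique:
  fixes m n i j :: nat
  assumes "m\<^sup>2 + i = n\<^sup>2 + j" "i \<le> 2 * m" "j \<le> 2 * n"
  shows "m = n"
proof -
  have less: "a\<^sup>2 + k < b\<^sup>2" if "a < b" "k \<le> 2 * a" for a b k :: nat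
  proof -
    have "(Suc a)\<^sup>2 \<le> b\<^sup>2" using that by (intro power_mono) auto
    then show ?thesis using that by (simp add: power2_eq_square)
  qed
  show ?thesis using less[of m n i] less[of n m j] assms by (metis linorder_neqE_nat not_add_less1)
qed

text \<open>Source and target of a pattern are shifted by the same \<open>c\<close>. As
  \<open>c\<close> can exceed any \<open>m\<close>, successive patterns can be placed at
  nondecreasing positions.\<close>

definition universal_chart :: "(nat \<rightharpoonup> nat) \<Rightarrow> bool" where
  "universal_chart u \<longleftrightarrow> (\<forall>(B :: nat set) a b m. finite B \<longrightarrow> inj_on a B \<longrightarrow> inj_on b B
     \<longrightarrow> (\<exists>c\<ge>m. \<forall>x\<in>B. u (c + a x) = Some (c + b x)))"

text \<open>Every pattern, given as a list of pairs, is planted in infinitely many of the disjoint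
  blocks \<open>{N\<^sup>2..N\<^sup>2 + 2 * N}\<close>.\<close>

lemma exists_universal_chart:
  obtains u where "inj_on u (dom u)" "universal_chart u"
proof -
  \<comment> \<open>The second component of the decoded pair is ignored, so each pattern recurs for
    infinitely many \<open>N\<close>.\<close>
  define pat :: "nat \<Rightarrow> (nat \<times> nat) set" where "pat N = set (from_nat (fst (prod_decode N)))" for N
  \<comment> \<open>Patterns that are not partial injections are discarded, which keeps
    \<open>E\<close> the graph of one.\<close>
  define E where "E = {(N\<^sup>2 + i, N\<^sup>2 + k) |N i k. i \<le> 2 * N \<and> k \<le> 2 * N \<and> (i, k) \<in> pat N
    \<and> single_valued (pat N) \<and> single_valued ((pat N)\<inverse>)}"
  define u where "u n = (if \<exists>m. (n, m) \<in> E then Some (THE m. (n, m) \<in> E) else None)" for n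
  have sv: "m = m'" if E: "(n, m) \<in> E" "(n, m') \<in> E" for n m m'
  proof -
    obtain N i k where 1: "n = N\<^sup>2 + i" "m = N\<^sup>2 + k" "i \<le> 2 * N" "(i, k) \<in> pat N"
      "single_valued (pat N)"
      using E(1) unfolding E_def by blast
    obtain N' i' k' where 2: "n = N'\<^sup>2 + i'" "m' = N'\<^sup>2 + k'" "i' \<le> 2 * N'" "(i', k') \<in> pat N'"
      using E(2) unfolding E_def by blast
    have "N = N'" using 1 2 square_block_unique[of N i N' i'] by simp
    moreover from this have "i = i'" using 1 2 by simp
    ultimately show ?thesis using 1 2 by (auto dest: single_valuedD)
  qed
  have inj: "n = n'" if E: "(n, m) \<in> E" "(n', m) \<in> E" for n n' m
  proof -
    obtain N i k where 1: "n = N\<^sup>2 + i" "m = N\<^sup>2 + k" "k \<le> 2 * N" "(i, k) \<in> pat N"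
      "single_valued ((pat N)\<inverse>)"
      using E(1) unfolding E_def by blast
    obtain N' i' k' where 2: "n' = N'\<^sup>2 + i'" "m = N'\<^sup>2 + k'" "k' \<le> 2 * N'" "(i', k') \<in> pat N'"
      using E(2) unfolding E_def by blast
    have "N = N'" using 1 2 square_block_unique[of N k N' k'] by simp
    moreover from this have "k = k'" using 1 2 by simp
    ultimately show ?thesis using 1 2 by (auto dest: single_valuedD)
  qed
  have u_iff: "u n = Some m \<longleftrightarrow> (n, m) \<in> E" for n m
  proof
    assume "u n = Some m"
    then show "(n, m) \<in> E" using sv unfolding u_def by (metis option.discI option.inject theI)
  next
    assume "(n, m) \<in> E"
    then show "u n = Some m" using sv unfolding u_def by (auto intro!: the_equality)
  qed
  show thesis
  proof
    show "inj_on u (dom u)"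
      by (rule inj_onI) (auto simp: u_iff intro: inj)
  next
    show "universal_chart u"
      unfolding universal_chart_def
    proof (intro allI impI)
      fix B :: "nat set" and a b :: "nat \<Rightarrow> nat" and m
      assume fin: "finite B" and a: "inj_on a B" and b: "inj_on b B"
      define G where "G = (\<lambda>x. (a x, b x)) ` B"
      obtain w where w: "set w = G" using finite_list[of G] fin by (auto simp: G_def)
      \<comment> \<open>Since \<open>K \<le> N\<close> below, the block starts at or after
        \<open>m\<close> and is long enough for every offset.\<close>
      define K where "K = m + (\<Sum>x\<in>B. a x + b x)"
      define N where "N = prod_encode (to_nat w, K)"
      have "K \<le> N" unfolding N_def by (rule le_prod_encode_2)
      have "pat N = G" unfolding pat_def N_def by (simp add: w)
      have sG: "single_valued G" "single_valued (G\<inverse>)"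
        unfolding G_def single_valued_def using a b by (auto dest: inj_onD)
      show "\<exists>c\<ge>m. \<forall>x\<in>B. u (c + a x) = Some (c + b x)"
      proof (intro exI[of _ "N\<^sup>2"] conjI ballI)
        show "m \<le> N\<^sup>2" using \<open>K \<le> N\<close> le_square[of N] unfolding K_def power2_eq_square
          by linarith
      next
        fix x assume "x \<in> B"
        then have "a x + b x \<le> (\<Sum>x\<in>B. a x + b x)" using fin by (intro member_le_sum) auto
        then have "a x + b x \<le> N" using \<open>K \<le> N\<close> unfolding K_def by linarith
        moreover have "(a x, b x) \<in> pat N" using \<open>x \<in> B\<close> \<open>pat N = G\<close> unfolding G_def by blast
        ultimately have "(N\<^sup>2 + a x, N\<^sup>2 + b x) \<in> E"
          unfolding E_def using sG \<open>pat N = G\<close>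
          by (intro CollectI exI[of _ N] exI[of _ "a x"] exI[of _ "b x"]) simp
        then show "u (N\<^sup>2 + a x) = Some (N\<^sup>2 + b x)" by (simp add: u_iff)
      qed
    qed
  qed
qed

text \<open>Each fibre of \<open>d\<close> is a finite pattern, and dependent choice places the
  fibres one after another.\<close>

lemma universal_blocks:
  fixes u :: "nat \<rightharpoonup> nat" and P :: "nat set" and a b d :: "nat \<Rightarrow> nat"
  assumes u: "universal_chart u"
    and "\<And>j. finite {x\<in>P. d x = j}" "inj_on a P" "inj_on b P"
  obtains c where "mono c" "\<And>x. x \<in> P \<Longrightarrow> u (c (d x) + a x) = Some (c (d x) + b x)"
proof -
  define good where "good j c \<longleftrightarrow> (\<forall>x\<in>P. d x = j \<longrightarrow> u (c + a x) = Some (c + b x))" for j c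
  have block: "\<exists>c\<ge>m. good j c" for j m
  proof -
    have "inj_on a {x\<in>P. d x = j}" "inj_on b {x\<in>P. d x = j}"
      using inj_on_subset[OF assms(3)] inj_on_subset[OF assms(4)] by simp_all
    with u assms(2)[of j] have "\<exists>c\<ge>m. \<forall>x\<in>{x\<in>P. d x = j}. u (c + a x) = Some (c + b x)"
      unfolding universal_chart_def by blast
    then show ?thesis unfolding good_def by fastforce
  qed
  obtain c where c: "\<And>j. good j (c j)" "\<And>j. c j \<le> c (Suc j)"
    using dependent_nat_choice[of good "\<lambda>_. (\<le>)"] block by metis
  have "mono c" using c(2) by (simp add: mono_iff_le_Suc)
  then show thesis using c(1) by (intro that) (auto simp: good_def)
qed

section \<open>Interleaving two orders of type \<open>\<omega>\<close>\<close>

text \<open>For strictly increasing \<open>s\<close>, this numbers the interval between consecutive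
  thresholds in which \<open>n\<close> lies.\<close>

definition threshold_rank :: "(nat \<Rightarrow> nat) \<Rightarrow> nat \<Rightarrow> nat" where
  "threshold_rank s n = card {j. s j \<le> n}"

lemma finite_thresholds:
  fixes s :: "nat \<Rightarrow> nat"
  assumes "strict_mono s"
  shows "finite {j. s j \<le> n}"
proof (rule finite_subset)
  show "{j. s j \<le> n} \<subseteq> {..n}"
    using strict_mono_imp_increasing[OF assms] by (auto intro: order_trans)
qed simp

lemma threshold_rank_lessD:
  assumes "strict_mono s" "threshold_rank s m < threshold_rank s n"
  shows "\<exists>j. m < s j \<and> s j \<le> n"
proof (rule ccontr)
  assume "\<not> ?thesis"
  then have "{j. s j \<le> n} \<subseteq> {j. s j \<le> m}" by force
  then show False using assms card_mono[OF finite_thresholds] unfolding threshold_rank_def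
    by (metis leD)
qed

lemma less_threshold_rank:
  assumes "strict_mono s"
  shows "n < s (threshold_rank s n)"
proof (rule ccontr)
  assume "\<not> ?thesis"
  then have "{..threshold_rank s n} \<subseteq> {j. s j \<le> n}"
    using strict_mono_mono[OF assms] by (auto simp: not_less dest: monoD intro: order_trans)
  then have "card {..threshold_rank s n} \<le> threshold_rank s n"
    unfolding threshold_rank_def by (intro card_mono finite_thresholds assms)
  then show False by simp
qed

text \<open>By injectivity only finitely many points have \<open>x\<close> or
  \<open>\<phi> x\<close> below a given bound, so the next threshold can be put above both values
  for all of them.\<close>

lemma exists_common_thresholds:
  fixes \<phi> :: "nat \<Rightarrow> nat"
  assumes "inj_on \<phi> P"
  obtains t where "strict_mono t"
    "\<And>x n. x \<in> P \<Longrightarrow> x < t n \<Longrightarrow> \<phi> x < t (Suc n)"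
    "\<And>x n. x \<in> P \<Longrightarrow> \<phi> x < t n \<Longrightarrow> x < t (Suc n)"
proof -
  have step: "\<exists>m'>m. \<forall>x\<in>P. x < m \<or> \<phi> x < m \<longrightarrow> x < m' \<and> \<phi> x < m'" for m
  proof -
    let ?A = "{x\<in>P. x < m \<or> \<phi> x < m}"
    have "finite (\<phi> -` {..<m} \<inter> P)" using assms by (intro finite_vimage_IntI) auto
    then have "finite ({..<m} \<union> (\<phi> -` {..<m} \<inter> P))" by simp
    then have fin: "finite ?A" by (rule rev_finite_subset) auto
    let ?m = "Suc (m + (\<Sum>x\<in>?A. x + \<phi> x))"
    have "x + \<phi> x \<le> (\<Sum>x\<in>?A. x + \<phi> x)" if "x \<in> ?A" for x
      using fin that by (intro member_le_sum) auto
    then have "\<forall>x\<in>P. x < m \<or> \<phi> x < m \<longrightarrow> x < ?m \<and> \<phi> x < ?m" by fastforce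
    then show ?thesis by (intro exI[of _ ?m]) auto
  qed
  obtain t where t: "\<And>n. t n < t (Suc n) \<and>
      (\<forall>x\<in>P. x < t n \<or> \<phi> x < t n \<longrightarrow> x < t (Suc n) \<and> \<phi> x < t (Suc n))"
    using dependent_nat_choice[of "\<lambda>_ _. True" "\<lambda>_ m m'. m' > m \<and>
      (\<forall>x\<in>P. x < m \<or> \<phi> x < m \<longrightarrow> x < m' \<and> \<phi> x < m')"] step by blast
  show thesis by (rule that[of t]) (use t in \<open>auto simp: strict_mono_Suc_iff\<close>)
qed

text \<open>The order induced by \<open>p\<close> shares infinitely many initial segments with the
  standard order and infinitely many with the order induced by \<open>\<phi>\<close>.\<close>

lemma exists_interleaved_order:
  fixes \<phi> :: "nat \<Rightarrow> nat"
  assumes "inj_on \<phi> P"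
  obtains p d0 d1 :: "nat \<Rightarrow> nat"
  where "inj_on p P" "\<And>j. finite {x\<in>P. d0 x = j}" "\<And>j. finite {x\<in>P. d1 x = j}"
    and "\<And>x y. \<lbrakk>x \<in> P; y \<in> P; d0 x < d0 y\<rbrakk> \<Longrightarrow> x < y \<and> p x < p y"
    and "\<And>x y. \<lbrakk>x \<in> P; y \<in> P; d1 x < d1 y\<rbrakk> \<Longrightarrow> p x < p y \<and> \<phi> x < \<phi> y"
proof -
  obtain t where t: "strict_mono t"
    "\<And>x n. x \<in> P \<Longrightarrow> x < t n \<Longrightarrow> \<phi> x < t (Suc n)"
    "\<And>x n. x \<in> P \<Longrightarrow> \<phi> x < t n \<Longrightarrow> x < t (Suc n)"
    using exists_common_thresholds[OF assms] by blast
  \<comment> \<open>Even thresholds cut the standard order, odd ones the order induced by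
    \<open>\<phi>\<close>; the alternation makes the two families of cuts compatible.\<close>
  define e o' where "e j = t (2 * j)" and "o' j = t (Suc (2 * j))" for j
  have e: "strict_mono e" and o': "strict_mono o'"
    using t(1) unfolding e_def o'_def by (auto simp: strict_mono_def)
  define d0 d1 where "d0 x = threshold_rank e x" and "d1 x = threshold_rank o' (\<phi> x)" for x
  define l where "l x = d0 x + d1 x" for x
  \<comment> \<open>\<open>p\<close> sorts by level \<open>l\<close> first and by \<open>x\<close>
    within a level. As \<open>x < e (l x)\<close>, the summand \<open>e (l x)\<close> reserves
    enough room for that level.\<close>
  define p where "p x = (\<Sum>i<l x. e i) + x" for x
  \<comment> \<open>\<open>d0\<close> and \<open>d1\<close> never rank two elements oppositely:
    crossing cuts \<open>e j\<close> and \<open>o' i\<close> contradict the first growth bound on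
    \<open>t\<close> if \<open>j \<le> i\<close>, and the second otherwise.\<close>
  have compat: "\<not> d1 y < d1 x" if xy: "x \<in> P" "y \<in> P" "d0 x < d0 y" for x y
  proof
    assume "d1 y < d1 x"
    then obtain i where i: "\<phi> y < o' i" "o' i \<le> \<phi> x"
      using threshold_rank_lessD[OF o'] unfolding d1_def by blast
    obtain j where j: "x < e j" "e j \<le> y"
      using threshold_rank_lessD[OF e] xy(3) unfolding d0_def by blast
    show False
    proof (cases "j \<le> i")
      case True
      have "\<phi> x < o' j" using t(2) xy j unfolding e_def o'_def by blast
      also have "o' j \<le> o' i" using True o' by (simp add: strict_mono_less_eq)
      finally show False using i by simp
    next
      case False
      have "y < t (Suc (Suc (2 * i)))" using t(3) xy i unfolding o'_def by blast
      also have "\<dots> = e (Suc i)" by (simp add: e_def)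
      also have "\<dots> \<le> e j" using False e by (simp add: strict_mono_less_eq)
      finally show False using j by simp
    qed
  qed
  have p_less: "p x < p y" if "l x < l y" for x y
  proof -
    have "x < e (d0 x)" unfolding d0_def by (rule less_threshold_rank[OF e])
    also have "\<dots> \<le> e (l x)" using e by (simp add: strict_mono_less_eq l_def)
    finally have "p x < (\<Sum>i<Suc (l x). e i)" by (simp add: p_def)
    also have "\<dots> \<le> (\<Sum>i<l y. e i)" using that by (intro sum_mono2) auto
    finally show ?thesis by (simp add: p_def)
  qed
  show thesis
  proof
    show "inj_on p P"
    proof (rule inj_onI)
      fix x y assume "p x = p y"
      then have "l x = l y" using p_less by (metis linorder_neqE_nat nat_neq_iff)
      then show "x = y" using \<open>p x = p y\<close> by (simp add: p_def)
    qed
    show "finite {x\<in>P. d0 x = j}" for j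
      by (rule finite_subset[of _ "{..<e j}"]) (auto simp: d0_def intro: less_threshold_rank[OF e])
    show "finite {x\<in>P. d1 x = j}" for j
    proof (rule finite_subset)
      show "{x\<in>P. d1 x = j} \<subseteq> \<phi> -` {..<o' j} \<inter> P"
        by (auto simp: d1_def intro: less_threshold_rank[OF o'])
      show "finite (\<phi> -` {..<o' j} \<inter> P)" using assms by (intro finite_vimage_IntI) auto
    qed
  next
    fix x y assume xy: "x \<in> P" "y \<in> P" "d0 x < d0 y"
    then have "l x < l y" using compat[OF xy] unfolding l_def by linarith
    moreover have "x < y" using threshold_rank_lessD[OF e] xy(3) unfolding d0_def
      by (meson order_less_le_trans)
    ultimately show "x < y \<and> p x < p y" using p_less by blast
  next
    fix x y assume xy: "x \<in> P" "y \<in> P" "d1 x < d1 y"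
    then have "l x < l y" using compat[of y x] unfolding l_def by fastforce
    moreover have "\<phi> x < \<phi> y" using threshold_rank_lessD[OF o'] xy(3) unfolding d1_def
      by (meson order_less_le_trans)
    ultimately show "p x < p y \<and> \<phi> x < \<phi> y" using p_less by blast
  qed
qed

section \<open>Order-indiscernible sequences\<close>

text \<open>Ramsey's theorem colours sets of one fixed size \<open>m\<close>; a common tail past all
  entries pads two shorter lists to that size.\<close>

lemma exists_strict_sorted_extension:
  fixes l :: "nat list"
  assumes "strict_sorted l" "strict_sorted l'" "length l = length l'" "length l \<le> m"
  obtains r where "strict_sorted (l @ r)" "strict_sorted (l' @ r)" "length (l @ r) = m"
proof -
  define k where "k = Suc (sum_list l + sum_list l')"
  have "x < k" if "x \<in> set l \<union> set l'" for x
    using that member_le_sum_list[of x l] member_le_sum_list[of x l'] unfolding k_def by auto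
  then have "\<forall>x\<in>set l \<union> set l'. \<forall>z\<in>set [k..<k + (m - length l)]. x < z" by fastforce
  moreover have "strict_sorted [k..<k + (m - length l)]" by (simp add: strict_sorted_iff)
  ultimately show thesis
    using assms by (intro that[of "[k..<k + (m - length l)]"]) (auto simp: sorted_wrt_append)
qed

text \<open>Colour an \<open>m\<close>-set by which position patterns in it yield tuples of which
  relations. In a homogeneous set, a tuple and its increasing re-indexing occupy the same positions
  of two \<open>m\<close>-sets of equal colour.\<close>

lemma exists_order_indiscernibles:
  fixes e :: "nat \<Rightarrow> 'a" and Rs :: "'a list set set" and ar :: "'a list set \<Rightarrow> nat"
  assumes "finite Rs"
  obtains h :: "nat \<Rightarrow> nat" where "strict_mono h"
    and "\<And>R ns g. \<lbrakk>R \<in> Rs; length ns = ar R; strict_mono_on (set ns) g\<rbrakk>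
      \<Longrightarrow> map (\<lambda>n. e (h (g n))) ns \<in> R \<longleftrightarrow> map (\<lambda>n. e (h n)) ns \<in> R"
proof -
  \<comment> \<open>The sum bounds every arity, so the entries of any relevant tuple fit into an
    \<open>m\<close>-set.\<close>
  define m where "m = (\<Sum>R\<in>Rs. ar R)"
  define D where "D = (SIGMA R:Rs. {\<sigma>. set \<sigma> \<subseteq> {..<m} \<and> length \<sigma> = ar R})"
  have "finite D" unfolding D_def using assms by (intro finite_SigmaI finite_lists_length_eq) auto
  define col where
    "col S = {(R, \<sigma>) \<in> D. map (\<lambda>i. e (sorted_list_of_set S ! i)) \<sigma> \<in> R}" for S
  obtain F :: "('a list set \<times> nat list) set \<Rightarrow> nat" and k
    where F: "F ` Pow D = {i. i < k}" "inj_on F (Pow D)"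
    using finite_imp_inj_to_nat_seg[of "Pow D"] \<open>finite D\<close> by auto
  have col: "col S \<in> Pow D" for S unfolding col_def by auto
  have "\<forall>S. S \<subseteq> UNIV \<and> finite S \<and> card S = m \<longrightarrow> F (col S) < k" using F(1) col by blast
  then obtain Y c where Y: "infinite Y" "\<And>S. S \<subseteq> Y \<Longrightarrow> finite S \<Longrightarrow> card S = m \<Longrightarrow> F (col S) = c"
    using Ramsey[of UNIV m "\<lambda>S. F (col S)" k] by auto
  have col_eq: "col S = col S'" if "S \<subseteq> Y" "finite S" "card S = m" "S' \<subseteq> Y" "finite S'" "card S' = m"
    for S S'
    using F(2) col Y(2) that by (metis inj_onD)
  define h where "h = enumerate Y"
  have h: "strict_mono h" "range h = Y"
    unfolding h_def using Y(1) by (auto simp: strict_mono_enumerate range_enumerate)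
  show thesis
  proof
    show "strict_mono h" by fact
  next
    fix R ns and g :: "nat \<Rightarrow> nat"
    assume R: "R \<in> Rs" and ns: "length ns = ar R" and g: "strict_mono_on (set ns) g"
    define l where "l = sorted_list_of_set (set ns)"
    have l: "strict_sorted l" "set l = set ns" unfolding l_def by auto
    have gl: "strict_sorted (map g l)"
      using l g by (auto simp: sorted_wrt_map strict_mono_on_def intro: sorted_wrt_mono_rel[OF _ l(1)])
    have "length l \<le> length ns" unfolding l_def by (simp add: card_length)
    also have "\<dots> \<le> m" unfolding ns m_def using assms R by (intro member_le_sum) auto
    finally have len: "length l \<le> m" .
    obtain r where r: "strict_sorted (l @ r)" "strict_sorted (map g l @ r)" "length (l @ r) = m"
      using exists_strict_sorted_extension[OF l(1) gl _ len] by auto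
    \<comment> \<open>\<open>pos\<close> locates an entry in \<open>l\<close>; the same position of
      \<open>map g l\<close> holds its image under \<open>g\<close>, so \<open>map pos ns\<close> is
      a pattern common to both tuples.\<close>
    have "\<forall>n\<in>set ns. \<exists>i<length l. l ! i = n" using l(2) by (metis in_set_conv_nth)
    then obtain pos where pos: "\<And>n. n \<in> set ns \<Longrightarrow> pos n < length l \<and> l ! pos n = n" by metis
    have hS: "sorted_list_of_set (h ` set q) = map h q" "h ` set q \<subseteq> Y" "card (h ` set q) = length q"
      if "strict_sorted q" for q
    proof -
      have "strict_sorted (map h q)"
        using that h(1) by (auto simp: sorted_wrt_map strict_mono_def intro: sorted_wrt_mono_rel[OF _ that])
      then show "sorted_list_of_set (h ` set q) = map h q"
        using sorted_list_of_set.idem_if_sorted_distinct[of "map h q"] by (simp add: strict_sorted_iff)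
      show "h ` set q \<subseteq> Y" using h(2) by blast
      show "card (h ` set q) = length q"
        using that h(1) card_image[of h "set q"]
        by (simp add: strict_sorted_iff distinct_card strict_mono_imp_inj_on inj_on_subset)
    qed
    have "col (h ` set (l @ r)) = col (h ` set (map g l @ r))"
      using hS[OF r(1)] hS[OF r(2)] r(3) by (intro col_eq) simp_all
    moreover have "(R, map pos ns) \<in> D"
      unfolding D_def using R ns pos len by fastforce
    ultimately have "map (\<lambda>i. e (map h (l @ r) ! i)) (map pos ns) \<in> R
        \<longleftrightarrow> map (\<lambda>i. e (map h (map g l @ r) ! i)) (map pos ns) \<in> R"
      unfolding col_def hS[OF r(1)] hS[OF r(2)] by blast
    moreover have "map (\<lambda>i. e (map h (l @ r) ! i)) (map pos ns) = map (\<lambda>n. e (h n)) ns"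
      using pos by (auto simp: nth_append)
    moreover have "map (\<lambda>i. e (map h (map g l @ r) ! i)) (map pos ns) = map (\<lambda>n. e (h (g n))) ns"
      using pos by (auto simp: nth_append)
    ultimately show "map (\<lambda>n. e (h (g n))) ns \<in> R \<longleftrightarrow> map (\<lambda>n. e (h n)) ns \<in> R"
      by (simp only:)
  qed
qed

section \<open>Charts given by two parametrizations\<close>

text \<open>Domain and range share an index set, so composing with a chart defined on the range only
  replaces the second parametrization.\<close>

definition transfer :: "'i set \<Rightarrow> ('i \<Rightarrow> 'a) \<Rightarrow> ('i \<Rightarrow> 'a) \<Rightarrow> 'a \<rightharpoonup> 'a" where
  "transfer P a b x = (if x \<in> a ` P then Some (b (inv_into P a x)) else None)"

lemma dom_transfer [simp]: "dom (transfer P a b) = a ` P"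
  by (auto simp: transfer_def dom_def)

lemma transfer_apply: "inj_on a P \<Longrightarrow> i \<in> P \<Longrightarrow> transfer P a b (a i) = Some (b i)"
  by (simp add: transfer_def)

lemma transfer_comp:
  assumes "\<And>i. i \<in> P \<Longrightarrow> g (b i) = Some (c i)"
  shows "transfer P a b \<odot> g = transfer P a c"
  using assms by (auto simp: fun_eq_iff chart_comp_def map_comp_def transfer_def inv_into_into)

lemma transfer_in_sym_inv_monoid:
  assumes "inj_on a P" "inj_on b P" "a ` P \<subseteq> X" "b ` P \<subseteq> X"
  shows "transfer P a b \<in> sym_inv_monoid X"
proof -
  have "ran (transfer P a b) \<subseteq> X"
    using assms(4) by (auto simp: ran_def transfer_def inv_into_into split: if_splits)
  moreover have "inj_on (transfer P a b) (a ` P)"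
    using assms(1,2) by (auto simp: inj_on_def transfer_apply)
  ultimately show ?thesis using assms(3) by (simp add: sym_inv_monoid_def)
qed

text \<open>A tuple over the domain is \<open>map a \<sigma>\<close> for some
  \<open>\<sigma>\<close> over \<open>P\<close>, and its image is
  \<open>map b \<sigma>\<close>.\<close>

lemma transfer_in_pAut:
  assumes "transfer P a b \<in> sym_inv_monoid X" "inj_on a P"
    and "\<And>R \<sigma>. \<lbrakk>R \<in> Rs; set \<sigma> \<subseteq> P; length \<sigma> = arity X R\<rbrakk> \<Longrightarrow> map b \<sigma> \<in> R \<longleftrightarrow> map a \<sigma> \<in> R"
  shows "transfer P a b \<in> pAut X Rs"
proof -
  have "tuple_image (transfer P a b) \<alpha> \<in> R \<longleftrightarrow> \<alpha> \<in> R"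
    if R: "R \<in> Rs" and \<alpha>: "\<alpha> \<in> tuples (a ` P) (arity X R)" for R \<alpha>
  proof -
    define \<sigma> where "\<sigma> = map (inv_into P a) \<alpha>"
    have \<sigma>: "set \<sigma> \<subseteq> P" "map a \<sigma> = \<alpha>" "length \<sigma> = arity X R"
      using \<alpha> unfolding \<sigma>_def tuples_def
      by (auto simp: inv_into_into subset_iff f_inv_into_f map_idI)
    have "tuple_image (transfer P a b) \<alpha> = map b \<sigma>"
      unfolding tuple_image_def \<sigma>(2)[symmetric] using \<sigma>(1) assms(2) by (auto simp: transfer_apply)
    then show ?thesis using assms(3)[OF R \<sigma>(1,3)] \<sigma>(2) by simp
  qed
  then show ?thesis using assms(1) by (simp add: pAut_def)
qed

text \<open>Numbering \<open>X\<close> by \<open>e\<close> turns a chart into an injection on a set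
  of naturals, where orders can be compared.\<close>

lemma chart_eq_transfer:
  assumes "f \<in> sym_inv_monoid X" "bij_betw e UNIV X"
  obtains P \<phi> where "inj_on \<phi> P" "f = transfer P e (e \<circ> \<phi>)"
proof
  let ?P = "e -` dom f" and ?\<phi> = "\<lambda>n. inv e (the (f (e n)))"
  have e: "inj e" "range e = X" using assms(2) by (auto simp: bij_betw_def)
  have f: "dom f \<subseteq> X" "ran f \<subseteq> X" "inj_on f (dom f)"
    using assms(1) by (auto simp: sym_inv_monoid_def)
  have ef: "f (e n) = Some (e (?\<phi> n))" if n: "n \<in> ?P" for n
  proof -
    obtain y where "f (e n) = Some y" using n by auto
    moreover from this have "y \<in> range e" using f(2) e(2) by (auto intro: ranI)
    ultimately show ?thesis by (simp add: f_inv_into_f)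
  qed
  show "inj_on ?\<phi> ?P"
    by (rule inj_onI) (metis ef e(1) f(3) inj_onD injD vimageD)
  show "f = transfer ?P e (e \<circ> ?\<phi>)"
  proof
    fix x
    show "f x = transfer ?P e (e \<circ> ?\<phi>) x"
    proof (cases "x \<in> dom f")
      case True
      then obtain n where "x = e n" using f(1) e(2) by blast
      then show ?thesis using True ef[of n] e(1) inj_on_subset[OF e(1), of ?P]
        by (simp add: transfer_apply)
    next
      case False
      then have "x \<notin> e ` ?P" by auto
      then show ?thesis using False by (simp add: transfer_def domIff)
    qed
  qed
qed

section \<open>Factoring arbitrary charts through the indiscernible sequence\<close>

theorem corollary4p26:
  fixes X :: "'a set" and Rs :: "'a list set set"
  assumes "countable X" and "infinite X"
    and "relational_structure X Rs"
    and "finite Rs"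
  shows "approx_I X (pAut X Rs) (sym_inv_monoid X)"
proof -
  obtain e :: "nat \<Rightarrow> 'a" where e: "bij_betw e UNIV X"
    using bij_betw_from_nat_into assms(1,2) by blast
  then have einj: "inj e" and eX: "range e = X" by (auto simp: bij_betw_def)
  obtain h :: "nat \<Rightarrow> nat" where h: "strict_mono h"
    "\<And>R ns g. \<lbrakk>R \<in> Rs; length ns = arity X R; strict_mono_on (set ns) g\<rbrakk>
      \<Longrightarrow> map (\<lambda>n. e (h (g n))) ns \<in> R \<longleftrightarrow> map (\<lambda>n. e (h n)) ns \<in> R"
    using exists_order_indiscernibles[OF assms(4), of "arity X" e] by blast
  define y where "y n = e (h n)" for n
  have yinj: "inj y"
    using inj_compose[OF einj strict_mono_imp_inj_on[OF h(1)]] by (simp add: y_def[abs_def] o_def)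
  have yX: "range y \<subseteq> X" unfolding y_def using eX by auto
  obtain u where u: "inj_on u (dom u)" "universal_chart u"
    using exists_universal_chart by blast
  \<comment> \<open>\<open>\<theta>\<close> moves \<open>X\<close> onto the indiscernible sequence,
    \<open>\<theta>'\<close> moves it back, and \<open>\<mu>\<close> is \<open>u\<close> transported
    along \<open>y\<close>.\<close>
  define \<theta> where "\<theta> = transfer UNIV e y"
  define \<theta>' where "\<theta>' = transfer UNIV y e"
  define \<mu> where "\<mu> = transfer (dom u) y (\<lambda>n. y (the (u n)))"
  define U where "U = {\<theta>, \<theta>', \<mu>}"
  let ?S = "semigroup_span (pAut X Rs \<union> U)"
  have "inj_on (\<lambda>n. y (the (u n))) (dom u)"
    by (rule inj_onI) (metis domD injD[OF yinj] inj_onD[OF u(1)] option.sel)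
  then have "U \<subseteq> sym_inv_monoid X"
    unfolding U_def \<theta>_def \<theta>'_def \<mu>_def
    using einj yinj eX yX by (auto intro!: transfer_in_sym_inv_monoid inj_on_subset[OF yinj])
  have U: "\<theta> \<in> ?S" "\<theta>' \<in> ?S" "\<mu> \<in> ?S" unfolding U_def by (auto intro: semigroup_span.incl)
  have \<mu>: "\<mu> (y m) = Some (y n)" if "u m = Some n" for m n
    using that transfer_apply[of y "dom u" m] inj_on_subset[OF yinj, of "dom u"]
    unfolding \<mu>_def by (simp add: domI)
  \<comment> \<open>On the entries of an index tuple, passing from \<open>a\<close> to
    \<open>b\<close> is an increasing re-indexing, so indiscernibility applies.\<close>
  have monotone: "transfer P (y \<circ> a) (y \<circ> b) \<in> ?S"
    if a: "inj_on a P" and ab: "\<And>i j. i \<in> P \<Longrightarrow> j \<in> P \<Longrightarrow> a i < a j \<Longrightarrow> b i < b j"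
    for a b :: "nat \<Rightarrow> nat" and P
  proof -
    have b: "inj_on b P"
      using ab a by (intro inj_onI) (metis inj_onD less_irrefl linorder_neqE_nat)
    have ya: "inj_on (y \<circ> a) P" and yb: "inj_on (y \<circ> b) P"
      using a b yinj by (auto intro: comp_inj_on inj_on_subset)
    have "transfer P (y \<circ> a) (y \<circ> b) \<in> pAut X Rs"
    proof (rule transfer_in_pAut[OF _ ya])
      show "transfer P (y \<circ> a) (y \<circ> b) \<in> sym_inv_monoid X"
        using ya yb yX by (intro transfer_in_sym_inv_monoid) auto
    next
      fix R \<sigma> assume R: "R \<in> Rs" and \<sigma>: "set \<sigma> \<subseteq> P" "length \<sigma> = arity X R"
      define g where "g n = b (inv_into P a n)" for n
      have g: "g (a i) = b i" if "i \<in> set \<sigma>" for i using that \<sigma>(1) a by (auto simp: g_def)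
      have "strict_mono_on (set (map a \<sigma>)) g"
        using g ab \<sigma>(1) by (auto simp: strict_mono_on_def subset_iff)
      from h(2)[OF R _ this] \<sigma>(2) g
      show "map (y \<circ> b) \<sigma> \<in> R \<longleftrightarrow> map (y \<circ> a) \<sigma> \<in> R"
        by (simp add: y_def o_def cong: map_cong)
    qed
    then show ?thesis by (auto intro: semigroup_span.incl)
  qed
  have "f \<in> ?S" if f_chart: "f \<in> sym_inv_monoid X" for f
  proof -
    obtain P \<phi> where \<phi>: "inj_on \<phi> P" and f: "f = transfer P e (e \<circ> \<phi>)"
      using chart_eq_transfer[OF f_chart e] by blast
    obtain p d0 d1 :: "nat \<Rightarrow> nat"
      where p: "inj_on p P" "\<And>j. finite {x\<in>P. d0 x = j}" "\<And>j. finite {x\<in>P. d1 x = j}"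
        "\<And>x y. \<lbrakk>x \<in> P; y \<in> P; d0 x < d0 y\<rbrakk> \<Longrightarrow> x < y \<and> p x < p y"
        "\<And>x y. \<lbrakk>x \<in> P; y \<in> P; d1 x < d1 y\<rbrakk> \<Longrightarrow> p x < p y \<and> \<phi> x < \<phi> y"
      using exists_interleaved_order[OF \<phi>] by blast
    \<comment> \<open>The blocks of \<open>d0\<close> let \<open>u\<close> exchange the standard
      order for that of \<open>p\<close>; those of \<open>d1\<close> then exchange it for that of
      \<open>\<phi>\<close>.\<close>
    obtain c0 where c0: "mono c0"
      "\<And>x. x \<in> P \<Longrightarrow> u (c0 (d0 x) + x) = Some (c0 (d0 x) + p x)"
      using universal_blocks[OF u(2) p(2) inj_on_id2 p(1)] by blast
    obtain c1 where c1: "mono c1"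
      "\<And>x. x \<in> P \<Longrightarrow> u (c1 (d1 x) + p x) = Some (c1 (d1 x) + \<phi> x)"
      using universal_blocks[OF u(2) p(3) p(1) \<phi>] by blast
    \<comment> \<open>Within a block the shift is constant; between blocks \<open>a\<close>
      increases with \<open>d\<close> and \<open>c\<close> does not decrease. Hence shifting changes
      no comparison.\<close>
    have shift_iff: "c (d i) + a i < c (d j) + a j \<longleftrightarrow> a i < a j"
      if "mono c" "i \<in> P" "j \<in> P" "\<And>x y. x \<in> P \<Longrightarrow> y \<in> P \<Longrightarrow> d x < d y \<Longrightarrow> a x < a y"
      for c d a :: "nat \<Rightarrow> nat" and i j
    proof (cases "d i" "d j" rule: linorder_cases)
      case less
      then show ?thesis using that monoD[OF that(1), of "d i" "d j"] by (simp add: add_le_less_mono)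
    next
      case equal
      then show ?thesis by simp
    next
      case greater
      then have "a j < a i" "c (d j) \<le> c (d i)" using that by (auto intro: monoD)
      then show ?thesis by simp
    qed
    define q0 q0' q1 q1' where "q0 x = c0 (d0 x) + x" and "q0' x = c0 (d0 x) + p x"
      and "q1 x = c1 (d1 x) + p x" and "q1' x = c1 (d1 x) + \<phi> x" for x
    have ord: "q0 i < q0 j \<longleftrightarrow> i < j" "q0' i < q0' j \<longleftrightarrow> p i < p j"
      "q1 i < q1 j \<longleftrightarrow> p i < p j" "q1' i < q1' j \<longleftrightarrow> \<phi> i < \<phi> j" if "i \<in> P" "j \<in> P" for i j
      unfolding q0_def q0'_def q1_def q1'_def
      using shift_iff[OF c0(1) that, of d0 "\<lambda>x. x"] shift_iff[OF c0(1) that, of d0 p]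
        shift_iff[OF c1(1) that, of d1 p] shift_iff[OF c1(1) that, of d1 \<phi>] p(4,5) by auto
    have inj_q: "inj_on q P" if "inj_on a P" "\<And>i j. i \<in> P \<Longrightarrow> j \<in> P \<Longrightarrow> q i < q j \<longleftrightarrow> a i < a j"
      for q a :: "nat \<Rightarrow> nat"
      using that by (intro inj_onI) (metis inj_onD less_irrefl linorder_neqE_nat)
    have q: "inj_on q0' P" "inj_on q1' P"
      using inj_q[OF p(1)] inj_q[OF \<phi>] ord by auto
    note step = semigroup_span.mult[where A = "pAut X Rs \<union> U"]
    \<comment> \<open>Starting from the identity on the domain of \<open>f\<close> gives every
      partial product exactly that domain.\<close>
    have "transfer P e e \<in> pAut X Rs"
      using inj_on_subset[OF einj, of P] eX
      by (intro transfer_in_pAut transfer_in_sym_inv_monoid) auto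
    then have "transfer P e e \<in> ?S" by (auto intro: semigroup_span.incl)
    moreover have "transfer P e e \<odot> \<theta> = transfer P e y"
      by (rule transfer_comp) (simp add: \<theta>_def transfer_apply einj)
    ultimately have "transfer P e y \<in> ?S" using step U(1) by metis
    moreover have "transfer P (y \<circ> id) (y \<circ> q0) \<in> ?S" by (rule monotone) (simp_all add: ord)
    moreover have "transfer P e y \<odot> transfer P (y \<circ> id) (y \<circ> q0) = transfer P e (y \<circ> q0)"
      using inj_on_subset[OF yinj, of P] by (intro transfer_comp) (simp add: transfer_apply)
    ultimately have "transfer P e (y \<circ> q0) \<in> ?S" using step by metis
    moreover have "transfer P e (y \<circ> q0) \<odot> \<mu> = transfer P e (y \<circ> q0')"
      by (rule transfer_comp) (simp add: \<mu> c0(2) q0_def q0'_def)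
    ultimately have "transfer P e (y \<circ> q0') \<in> ?S" using step U(3) by metis
    \<comment> \<open>Both \<open>q0'\<close> and \<open>q1\<close> order \<open>P\<close> as
      \<open>p\<close> does, so a monotone factor links the two uses of
      \<open>\<mu>\<close>.\<close>
    moreover have "transfer P (y \<circ> q0') (y \<circ> q1) \<in> ?S" by (rule monotone) (simp_all add: ord q)
    moreover have "transfer P e (y \<circ> q0') \<odot> transfer P (y \<circ> q0') (y \<circ> q1) = transfer P e (y \<circ> q1)"
      using comp_inj_on[OF q(1) inj_on_subset[OF yinj]]
      by (intro transfer_comp transfer_apply) auto
    ultimately have "transfer P e (y \<circ> q1) \<in> ?S" using step by metis
    moreover have "transfer P e (y \<circ> q1) \<odot> \<mu> = transfer P e (y \<circ> q1')"
      by (rule transfer_comp) (simp add: \<mu> c1(2) q1_def q1'_def)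
    ultimately have "transfer P e (y \<circ> q1') \<in> ?S" using step U(3) by metis
    \<comment> \<open>\<open>q1'\<close> orders \<open>P\<close> as \<open>\<phi>\<close> does, so
      the remaining shifts can be undone monotonically.\<close>
    moreover have "transfer P (y \<circ> q1') (y \<circ> \<phi>) \<in> ?S" by (rule monotone) (simp_all add: ord q)
    moreover have "transfer P e (y \<circ> q1') \<odot> transfer P (y \<circ> q1') (y \<circ> \<phi>) = transfer P e (y \<circ> \<phi>)"
      using comp_inj_on[OF q(2) inj_on_subset[OF yinj]]
      by (intro transfer_comp transfer_apply) auto
    ultimately have "transfer P e (y \<circ> \<phi>) \<in> ?S" using step by metis
    moreover have "transfer P e (y \<circ> \<phi>) \<odot> \<theta>' = transfer P e (e \<circ> \<phi>)"
      by (rule transfer_comp) (simp add: \<theta>'_def transfer_apply yinj)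
    ultimately show "f \<in> ?S" using step U(2) unfolding f by metis
  qed
  then have "le_I X (sym_inv_monoid X) (pAut X Rs)"
    unfolding le_I_def using \<open>U \<subseteq> sym_inv_monoid X\<close> by (intro exI[of _ U]) (auto simp: U_def)
  moreover have "le_I X (pAut X Rs) (sym_inv_monoid X)"
    unfolding le_I_def by (intro exI[of _ "{}"]) (auto simp: pAut_def intro: semigroup_span.incl)
  ultimately show ?thesis by (simp add: approx_I_def)
qed

end
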